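(* Let $p\geq 1$ and $k\geq 0$ be integers. Then $$\begin{aligned}{}_1F_2\Bigl(\tfrac12-p;\,\tfrac12,\tfrac32-p;\,-\tfrac{\pi^2(k+\frac12)^2}{4}\Bigr)=&\ \frac{(-1)^{p+1}\bigl(\pi(k+\frac12)\bigr)^{2p}}{\Gamma(2p-1)}\;{}_1F_2\Bigl(\tfrac12;\,\tfrac32,\tfrac32;\,-\tfrac{\pi^2(k+\frac12)^2}{4}\Bigr)\\&+\frac{(-1)^{k+p}\bigl(\pi(k+\frac12)\bigr)^{2p-1}}{\Gamma(2p-1)}\sum_{j=1}^{p-1}\frac{(-1)^j\,\Gamma(2j)}{\bigl(\pi(k+\frac12)\bigr)^{2j}}.\end{aligned}$$
   Context: ${}_1F_2(a;b,c;z)=\sum_{n\ge0}\frac{(a)_n}{(b)_n(c)_n}\frac{z^n}{n!}$ is the generalized hypergeometric function, $(a)_n$ being the rising Pochhammer symbol. A sum whose lower limit exceeds its upper limit is zero. *)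

theory Defs
  imports "HOL-Analysis.Analysis"
begin

definition hypergeo_1F2 :: "'a \<Rightarrow> 'a \<Rightarrow> 'a \<Rightarrow> 'a \<Rightarrow> 'a::{real_normed_field, banach}" where
  "hypergeo_1F2 a b c z =
     (\<Sum>n. pochhammer a n / (pochhammer b n * pochhammer c n) * (z ^ n / fact n))"

end

theory Submission imports Defs begin

text \<open>
  With \<open>a = 1/2 - p\<close>, \<open>(a)\<^sub>n / (a + 1)\<^sub>n = a / (a + n)\<close> and
  \<open>4\<^sup>n (1/2)\<^sub>n n! = (2n)!\<close> turn the left-hand side \<open>F\<^sub>p\<close> into the cosine series in
  \<open>x = \<pi>(k + 1/2)\<close>, its \<open>n\<close>-th term weighted by \<open>(2p - 1) / (2p - 1 - 2n)\<close>.
  Up to the factor \<open>-(2p - 1) x\<^bsup>2p-1\<^esup>\<close> this is the termwise antiderivative \<open>I\<^sub>p\<close> of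
  \<open>cos t / t\<^bsup>2p\<^esup>\<close>.  Integrating by parts twice relates \<open>I\<^bsub>p+1\<^esub>\<close> to
  \<open>I\<^sub>p\<close>, that is
  \[ F_{p+1} = \cos x - \frac{x \sin x}{2p} - \frac{x^2}{2p(2p-1)} F_p, \]
  and a single integration by parts gives \<open>F\<^sub>1 = cos x + x Si x\<close>, where \<open>Si x / x\<close> is the
  \<open>\<^sub>1F\<^sub>2\<close> on the right-hand side.  At \<open>x = \<pi>(k + 1/2)\<close> the cosine vanishes and
  the sine is \<open>(-1)\<^sup>k\<close>, so unrolling the recurrence produces the finite sum.

  No integrals occur in the proof: both relations (\<open>weighted_cos_step\<close>, \<open>weighted_cos_base\<close>) are
  identities between the weights of the cosine series, and stating them with \<open>sums\<close> carries
  convergence along the induction on \<open>p\<close>.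
\<close>

section \<open>Weighted cosine series\<close>

definition cos_term :: "real \<Rightarrow> nat \<Rightarrow> real" where
  "cos_term x n = (-1) ^ n * x ^ (2 * n) / fact (2 * n)"

lemma cos_term_sums: "cos_term x sums cos x"
  using cos_paired[of x] by (simp add: cos_term_def[abs_def])

lemma cos_term_Suc:
  "2 * real (Suc n) * (2 * real n + 1) * cos_term x (Suc n) = - (x\<^sup>2 * cos_term x n)"
proof -
  have "fact (2 * Suc n) = 2 * real (Suc n) * (2 * real n + 1) * fact (2 * n)"
    by (simp add: algebra_simps)
  then show ?thesis
    by (simp add: cos_term_def power2_eq_square del: of_nat_Suc fact_Suc)
qed

lemma x_sin_sums: "(\<lambda>n. - (2 * real n * cos_term x n)) sums (x * sin x)"
proof -
  have "x * ((-1) ^ n / fact (2 * n + 1) * x ^ (2 * n + 1)) =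
      - (2 * real (Suc n) * cos_term x (Suc n))" for n
  proof -
    have "fact (2 * Suc n) = 2 * real (Suc n) * fact (2 * n + 1)"
      by (simp add: algebra_simps)
    then show ?thesis
      by (simp add: cos_term_def del: of_nat_Suc fact_Suc)
  qed
  then have "(\<lambda>n. - (2 * real (Suc n) * cos_term x (Suc n))) sums (x * sin x)"
    using sums_mult[OF sin_paired[of x], of x] by simp
  from sums_Suc[OF this] show ?thesis
    by simp
qed

text \<open>Two integrations by parts, read off the weights.  Multiplying by \<open>x\<^sup>2\<close> moves each
  term of the cosine series to its successor, with a weight \<open>-2n(2n - 1)\<close>
  (\<open>cos_term_Suc\<close>); the claim then reduces to
  \[ 1 + \frac{2n}{2p} + \frac{2n(2n-1)}{2p(2p+1-2n)} = \frac{2p+1}{2p+1-2n}. \]\<close>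

lemma weighted_cos_step:
  fixes p :: nat
  assumes "p \<ge> 1"
    and s: "(\<lambda>n. (2 * real p - 1) / (2 * real p - 1 - 2 * real n) * cos_term x n) sums s"
  shows "(\<lambda>n. (2 * real (Suc p) - 1) / (2 * real (Suc p) - 1 - 2 * real n) * cos_term x n) sums
           (cos x - x * sin x / (2 * real p) - x\<^sup>2 * s / (2 * real p * (2 * real p - 1)))"
proof -
  have odd: "2 * real p + 1 - 2 * real n \<noteq> 0" for n
  proof
    assume "2 * real p + 1 - 2 * real n = 0"
    then have "real (2 * p + 1) = real (2 * n)" by simp
    then have "2 * p + 1 = 2 * n" by (simp only: of_nat_eq_iff)
    then show False by presburger
  qed
  have p: "real p \<ge> 1" using assms by simp
  let ?g = "\<lambda>n. 2 * real n * (2 * real n - 1) /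
              (2 * real p * (2 * real p + 1 - 2 * real n)) * cos_term x n"
  have "- (x\<^sup>2 / (2 * real p * (2 * real p - 1))) *
          ((2 * real p - 1) / (2 * real p - 1 - 2 * real n) * cos_term x n) = ?g (Suc n)" for n
  proof -
    have "?g (Suc n) = (2 * real (Suc n) * (2 * real n + 1) * cos_term x (Suc n)) /
        (2 * real p * (2 * real p - 1 - 2 * real n))"
      by (simp add: algebra_simps)
    also have "\<dots> = - (x\<^sup>2 * cos_term x n) / (2 * real p * (2 * real p - 1 - 2 * real n))"
      by (simp only: cos_term_Suc)
    finally show ?thesis using p by simp
  qed
  then have "(\<lambda>n. ?g (Suc n)) sums (- (x\<^sup>2 / (2 * real p * (2 * real p - 1))) * s)"
    using sums_mult[OF s, of "- (x\<^sup>2 / (2 * real p * (2 * real p - 1)))"] by simp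
  from sums_Suc[OF this]
  have g: "?g sums (- (x\<^sup>2 / (2 * real p * (2 * real p - 1))) * s)" by simp
  have weights: "cos_term x n + - (2 * real n * cos_term x n) * (- (1 / (2 * real p))) + ?g n =
      (2 * real (Suc p) - 1) / (2 * real (Suc p) - 1 - 2 * real n) * cos_term x n" for n
  proof -
    have "1 + 2 * real n / (2 * real p) + 2 * real n * (2 * real n - 1) /
              (2 * real p * (2 * real p + 1 - 2 * real n)) =
          (2 * real p + 1) / (2 * real p + 1 - 2 * real n)"
      using odd[of n] p by (simp add: divide_simps) (simp add: algebra_simps)
    from arg_cong[OF this, of "\<lambda>w. w * cos_term x n"] show ?thesis
      by (simp add: algebra_simps)
  qed
  show ?thesis
    using sums_add[OF sums_add[OF cos_term_sums[of x]
        sums_mult2[OF x_sin_sums[of x], of "- (1 / (2 * real p))"]] g]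
    unfolding weights by simp
qed

text \<open>One integration by parts, in the same way: after the shift by \<open>x\<^sup>2\<close> the weights
  satisfy \<open>1 + 2n / (1 - 2n) = 1 / (1 - 2n)\<close>.\<close>

lemma weighted_cos_base:
  assumes s: "(\<lambda>n. cos_term x n / (2 * real n + 1)\<^sup>2) sums s"
  shows "(\<lambda>n. 1 / (1 - 2 * real n) * cos_term x n) sums (cos x + x\<^sup>2 * s)"
proof -
  have odd: "1 - 2 * real n \<noteq> 0" for n
  proof
    assume "1 - 2 * real n = 0"
    then have "real 1 = real (2 * n)" by simp
    then have "1 = 2 * n" by (simp only: of_nat_eq_iff)
    then show False by presburger
  qed
  let ?g = "\<lambda>n. 2 * real n / (1 - 2 * real n) * cos_term x n"
  have "x\<^sup>2 * (cos_term x n / (2 * real n + 1)\<^sup>2) = ?g (Suc n)" for n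
  proof -
    have nz: "2 * real n + 1 \<noteq> 0" by linarith
    have "?g (Suc n) = - (2 * real (Suc n) * cos_term x (Suc n)) / (2 * real n + 1)"
      by (simp add: divide_simps) (simp add: algebra_simps)
    also have "\<dots> = - (2 * real (Suc n) * (2 * real n + 1) * cos_term x (Suc n)) /
        (2 * real n + 1)\<^sup>2"
      using nz by (simp add: power2_eq_square)
    finally show ?thesis by (simp only: cos_term_Suc) simp
  qed
  with sums_mult[OF s, of "x\<^sup>2"] have "(\<lambda>n. ?g (Suc n)) sums (x\<^sup>2 * s)" by simp
  from sums_Suc[OF this] have g: "?g sums (x\<^sup>2 * s)" by simp
  have weights: "cos_term x n + ?g n = 1 / (1 - 2 * real n) * cos_term x n" for n
    using odd[of n] by (simp add: divide_simps) (simp add: algebra_simps)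
  show ?thesis
    using sums_add[OF cos_term_sums[of x] g] unfolding weights .
qed

section \<open>The hypergeometric series as weighted cosine series\<close>

lemma pochhammer_add_1:
  fixes a :: real
  shows "a * pochhammer (a + 1) n = pochhammer a n * (a + real n)"
  using pochhammer_rec[of a n] pochhammer_Suc[of a n] by simp

lemma cos_term_pochhammer:
  "cos_term x n = (- (x\<^sup>2 / 4)) ^ n / (pochhammer (1/2) n * fact n)"
proof -
  have "(- (x\<^sup>2 / 4)) ^ n = (-1) ^ n * x ^ (2 * n) / 4 ^ n"
    by (simp add: power_minus[of "x\<^sup>2 / 4"] power_divide power_mult)
  then show ?thesis
    by (simp add: cos_term_def fact_double power_mult)
qed

lemma hypergeo_1F2_weighted_cos:
  fixes p :: nat
  assumes "p \<ge> 1"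
  shows "hypergeo_1F2 (1/2 - real p) (1/2) (3/2 - real p) (- (x\<^sup>2 / 4)) =
    (\<Sum>n. (2 * real p - 1) / (2 * real p - 1 - 2 * real n) * cos_term x n)"
proof -
  have nz: "1/2 - real p + real n \<noteq> 0" for n
  proof
    assume "1/2 - real p + real n = 0"
    then have "real (1 + 2 * n) = real (2 * p)" by simp
    then have "1 + 2 * n = 2 * p" by (simp only: of_nat_eq_iff)
    then show False by presburger
  qed
  have "pochhammer (1/2 - real p) n / (pochhammer (1/2) n * pochhammer (3/2 - real p) n) *
      ((- (x\<^sup>2 / 4)) ^ n / fact n) =
    (2 * real p - 1) / (2 * real p - 1 - 2 * real n) * cos_term x n" for n
  proof -
    let ?a = "1/2 - real p"
    have rec: "?a * pochhammer (3/2 - real p) n = pochhammer ?a n * (?a + real n)"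
      using pochhammer_add_1[of ?a n] by simp
    have "pochhammer ?a n \<noteq> 0"
    proof
      assume "pochhammer ?a n = 0"
      then obtain i where "i < n" "?a = - real i" by (auto simp: pochhammer_eq_0_iff)
      with nz[of i] show False by simp
    qed
    with rec nz[of n] nz[of 0] have "pochhammer (3/2 - real p) n \<noteq> 0" by auto
    with rec nz[of n]
    have "pochhammer ?a n / pochhammer (3/2 - real p) n = ?a / (?a + real n)"
      by (simp add: frac_eq_eq)
    also have "\<dots> = (2 * real p - 1) / (2 * real p - 1 - 2 * real n)"
      using nz[of n] by (simp add: frac_eq_eq) (simp add: divide_simps, simp add: algebra_simps)
    finally have ratio: "pochhammer ?a n / pochhammer (3/2 - real p) n = \<dots>" .
    have "pochhammer ?a n / (pochhammer (1/2) n * pochhammer (3/2 - real p) n) *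
        ((- (x\<^sup>2 / 4)) ^ n / fact n) =
      pochhammer ?a n / pochhammer (3/2 - real p) n * cos_term x n"
      unfolding cos_term_pochhammer by simp
    then show ?thesis by (simp only: ratio)
  qed
  then show ?thesis by (simp add: hypergeo_1F2_def)
qed

text \<open>Since \<open>(2n + 1)\<^sup>2 (2n)! = (2n + 1) (2n + 1)!\<close>, this is the series of
  \<open>Si x / x\<close>, the termwise integral of \<open>sin t / t\<close> divided by \<open>x\<close>.\<close>

lemma hypergeo_1F2_sinc_integral_sums:
  "(\<lambda>n. cos_term x n / (2 * real n + 1)\<^sup>2) sums hypergeo_1F2 (1/2) (3/2) (3/2) (- (x\<^sup>2 / 4))"
proof -
  have "pochhammer (1/2) n / (pochhammer (3/2) n * pochhammer (3/2) n) *
      ((- (x\<^sup>2 / 4)) ^ n / fact n) = cos_term x n / (2 * real n + 1)\<^sup>2" for n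
  proof -
    have "pochhammer (3/2) n = pochhammer (1/2) n * (2 * real n + 1)"
      using pochhammer_add_1[of "1/2" n] by (simp add: algebra_simps)
    moreover have "pochhammer (1/2::real) n > 0" by (rule pochhammer_pos) simp
    ultimately show ?thesis
      by (simp add: cos_term_pochhammer power2_eq_square)
  qed
  moreover have "summable (\<lambda>n. cos_term x n / (2 * real n + 1)\<^sup>2)"
  proof (rule summable_comparison_test')
    show "summable (\<lambda>n. inverse (fact n) * (x\<^sup>2) ^ n)" by (rule summable_exp)
    show "norm (cos_term x n / (2 * real n + 1)\<^sup>2) \<le> inverse (fact n) * (x\<^sup>2) ^ n" for n
    proof -
      have "fact n * 1 \<le> fact (2 * n) * (2 * real n + 1)\<^sup>2"
        by (intro mult_mono fact_mono one_le_power) auto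
      then have "(x\<^sup>2) ^ n / (fact (2 * n) * (2 * real n + 1)\<^sup>2) \<le> (x\<^sup>2) ^ n / fact n"
        by (intro divide_left_mono) (auto intro!: mult_pos_pos)
      moreover have "norm (cos_term x n / (2 * real n + 1)\<^sup>2) =
          \<bar>(x\<^sup>2) ^ n\<bar> / (fact (2 * n) * (2 * real n + 1)\<^sup>2)"
        by (simp add: cos_term_def abs_mult power_mult[symmetric])
      moreover have "\<bar>(x\<^sup>2) ^ n\<bar> = (x\<^sup>2) ^ n"
        by (intro abs_of_nonneg) simp
      ultimately show ?thesis
        by (simp only: divide_inverse mult.commute)
    qed
  qed
  ultimately show ?thesis by (simp add: hypergeo_1F2_def summable_sums)
qed

section \<open>Evaluation at the zeros of the cosine\<close>

lemma sin_half_odd_pi: "sin (pi * (real k + 1/2)) = (-1) ^ k"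
proof (induction k)
  case (Suc k)
  have "pi * (real (Suc k) + 1/2) = pi * (real k + 1/2) + pi" by (simp add: algebra_simps)
  then show ?case by (simp only: sin_periodic_pi Suc.IH) simp
qed simp

lemma cos_half_odd_pi: "cos (pi * (real k + 1/2)) = 0"
proof (induction k)
  case (Suc k)
  have "pi * (real (Suc k) + 1/2) = pi * (real k + 1/2) + pi" by (simp add: algebra_simps)
  then show ?case by (simp only: cos_periodic_pi Suc.IH minus_zero)
qed simp

text \<open>With \<open>p = q + 1\<close>, each step of the recurrence multiplies what is already there by
  \<open>-x\<^sup>2 / (2p(2p - 1))\<close>, whose product over the steps is \<open>(-1)\<^sup>q x\<^bsup>2q\<^esup> / (2q)!\<close>.
  The new summand \<open>-x sin x / (2p)\<close> has to be rescaled by the inverse of that product to enter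
  the sum, which is where \<open>(2j - 1)! / x\<^bsup>2j\<^esup>\<close> comes from.\<close>

lemma weighted_cos_closed_form:
  fixes k q :: nat
  defines "x \<equiv> pi * (real k + 1/2)"
  shows "(\<lambda>n. (2 * real (Suc q) - 1) / (2 * real (Suc q) - 1 - 2 * real n) * cos_term x n) sums
    ((-1) ^ q * x ^ (2 * q + 2) / fact (2 * q) * hypergeo_1F2 (1/2) (3/2) (3/2) (- (x\<^sup>2 / 4))
     - (-1) ^ (k + q) * x ^ (2 * q + 1) / fact (2 * q)
        * (\<Sum>j = 1..q. (-1) ^ j * fact (2 * j - 1) / x ^ (2 * j)))"
proof (induction q)
  case 0
  show ?case
    using weighted_cos_base[OF hypergeo_1F2_sinc_integral_sums[of x]]
    by (simp add: x_def cos_half_odd_pi power2_eq_square)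
next
  case (Suc q)
  let ?S = "hypergeo_1F2 (1/2) (3/2) (3/2) (- (x\<^sup>2 / 4))"
  let ?A = "\<Sum>j = 1..q. (-1) ^ j * fact (2 * j - 1) / x ^ (2 * j)"
  have x: "x > 0" by (simp add: x_def add_nonneg_pos)
  define d :: real where "d = 2 * real (Suc q) * (2 * real (Suc q) - 1)"
  have d: "d \<noteq> 0" by (simp add: d_def)
  have fact: "fact (2 * Suc q) = d * fact (2 * q)"
    by (simp add: d_def algebra_simps)
  \<comment> \<open>The summand \<open>j = q + 1\<close>, with its prefactor, is exactly the new sine term.\<close>
  have "(-1) ^ Suc q * fact (2 * Suc q - 1) / x ^ (2 * Suc q) =
      (-1) ^ Suc q * (fact (2 * Suc q) / (2 * real (Suc q))) / x ^ (2 * Suc q)"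
    by (simp add: fact_reduce[of "2 * Suc q"])
  then have "(-1) ^ (k + Suc q) * x ^ (2 * Suc q + 1) / fact (2 * Suc q) *
      ((-1) ^ Suc q * fact (2 * Suc q - 1) / x ^ (2 * Suc q)) =
      (-1) ^ k * ((-1) ^ Suc q * (-1) ^ Suc q) * x / (2 * real (Suc q))"
    using x by (simp add: power_add del: fact_Suc of_nat_Suc)
  also have "(-1) ^ Suc q * (-1) ^ Suc q = (1::real)"
    by (simp flip: power_mult_distrib)
  finally have last: "(-1) ^ (k + Suc q) * x ^ (2 * Suc q + 1) / fact (2 * Suc q) *
      ((-1) ^ Suc q * fact (2 * Suc q - 1) / x ^ (2 * Suc q)) =
      x * (-1) ^ k / (2 * real (Suc q))" by simp
  have "(-1) ^ Suc q * x ^ (2 * Suc q + 2) / fact (2 * Suc q) * ?S -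
      (-1) ^ (k + Suc q) * x ^ (2 * Suc q + 1) / fact (2 * Suc q) *
        (?A + (-1) ^ Suc q * fact (2 * Suc q - 1) / x ^ (2 * Suc q)) =
      0 - x * (-1) ^ k / (2 * real (Suc q)) - x\<^sup>2 *
        ((-1) ^ q * x ^ (2 * q + 2) / fact (2 * q) * ?S -
         (-1) ^ (k + q) * x ^ (2 * q + 1) / fact (2 * q) * ?A) / d"
  proof -
    have pow: "(-1) ^ Suc q * x ^ (2 * Suc q + 2) = - (x\<^sup>2 * ((-1) ^ q * x ^ (2 * q + 2)))"
      "(-1) ^ (k + Suc q) * x ^ (2 * Suc q + 1) = - (x\<^sup>2 * ((-1) ^ (k + q) * x ^ (2 * q + 1)))"
      by (simp_all add: power2_eq_square)
    have "- (x\<^sup>2 * a) / (d * F) * S - (- (x\<^sup>2 * b) / (d * F) * A + r) =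
        0 - r - x\<^sup>2 * (a / F * S - b / F * A) / d" if "F \<noteq> 0" for a b r F S A :: real
      using that d by (simp add: field_simps)
    then show ?thesis
      unfolding distrib_left last unfolding fact pow by simp
  qed
  then show ?case
    using weighted_cos_step[OF _ Suc.IH]
    by (simp add: x_def[symmetric] d_def
        cos_half_odd_pi[of k, folded x_def] sin_half_odd_pi[of k, folded x_def]
        del: fact_Suc of_nat_Suc power_Suc mult_Suc_right)
qed

lemma Gamma_double: "j \<ge> 1 \<Longrightarrow> Gamma (2 * real j) = fact (2 * j - 1)"
  using Gamma_fact[of "2 * j - 1", where 'a = real] by (simp add: of_nat_diff)

theorem mainTheorem14:
  fixes p k :: nat
  assumes "p \<ge> 1"
  shows "hypergeo_1F2 (1/2 - real p) (1/2) (3/2 - real p) (- (pi\<^sup>2 * (real k + 1/2)\<^sup>2 / 4)) =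
      (-1) ^ (p + 1) * (pi * (real k + 1/2)) ^ (2 * p) / Gamma (2 * real p - 1)
        * hypergeo_1F2 (1/2) (3/2) (3/2) (- (pi\<^sup>2 * (real k + 1/2)\<^sup>2 / 4))
      + (-1) ^ (k + p) * (pi * (real k + 1/2)) ^ (2 * p - 1) / Gamma (2 * real p - 1)
        * (\<Sum>j = 1..p - 1. (-1) ^ j * Gamma (2 * real j) / (pi * (real k + 1/2)) ^ (2 * j))"
proof -
  define x where "x = pi * (real k + 1/2)"
  have x2: "pi\<^sup>2 * (real k + 1/2)\<^sup>2 = x\<^sup>2" by (simp add: x_def power_mult_distrib)
  obtain q where q: "p = Suc q" using assms by (cases p) auto
  have Gamma: "Gamma (2 * real p - 1) = fact (2 * q)"
    using Gamma_fact[of "2 * q", where 'a = real] by (simp add: q algebra_simps)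
  have sum: "(\<Sum>j = 1..p - 1. (-1) ^ j * Gamma (2 * real j) / x ^ (2 * j)) =
      (\<Sum>j = 1..q. (-1) ^ j * fact (2 * j - 1) / x ^ (2 * j))"
    by (rule sum.cong) (simp_all add: q Gamma_double)
  have pow: "x ^ (2 * p) = x ^ (2 * q + 2)" "x ^ (2 * p - 1) = x ^ (2 * q + 1)"
    "(-1) ^ (p + 1) = ((-1) ^ q :: real)" "(-1) ^ (k + p) = (- ((-1) ^ (k + q)) :: real)"
    by (simp_all add: q)
  have "hypergeo_1F2 (1/2 - real p) (1/2) (3/2 - real p) (- (x\<^sup>2 / 4)) =
    (-1) ^ q * x ^ (2 * q + 2) / fact (2 * q) * hypergeo_1F2 (1/2) (3/2) (3/2) (- (x\<^sup>2 / 4))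
     - (-1) ^ (k + q) * x ^ (2 * q + 1) / fact (2 * q)
        * (\<Sum>j = 1..q. (-1) ^ j * fact (2 * j - 1) / x ^ (2 * j))"
    unfolding hypergeo_1F2_weighted_cos[OF assms] unfolding q
    by (rule sums_unique[OF weighted_cos_closed_form[of q k, folded x_def], symmetric])
  then show ?thesis
    unfolding x2 x_def[symmetric] Gamma sum pow by simp
qed

end
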